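(* There exist a set $\mathcal{X}$ and a class $\mathcal{F}\subseteq\mathcal{X}^{\mathcal{X}}$ such that $\mathcal{F}$ is learnable in the realizable setting but is not learnable in the agnostic setting under Markovian regret; that is, $\inf_{\mathcal{A}}\operatorname{M}_{\mathcal{A}}(T,\mathcal{F})=o(T)$ as $T\to\infty$, but it is not the case that $\inf_{\mathcal{A}}\operatorname{MR}_{\mathcal{A}}(T,\mathcal{F})=o(T)$, where the infima are over all (possibly randomized) learners.
   Context: $[T]=\{1,\dots,T\}$. A learner $\mathcal{A}$ is a (possibly randomized) rule that maps every finite sequence of states $x_{<t} := (x_0,\dots,x_{t-1})$ to a prediction $\mathcal{A}(x_{<t}) \in \mathcal{X}$. It may depend on $T$ and $\mathcal{F}$. Expectations below are over the learner's randomness. Expected number of mistakes in the realizable setting: $$\operatorname{M}_{\mathcal{A}}(T,\mathcal{F}) := \sup_{x_0\in\mathcal{X}}\ \sup_{f\in\mathcal{F}}\ \mathbb{E}\Big[\sum_{t=1}^T \mathbf{1}\{\mathcal{A}(x_{<t}) \neq f(x_{t-1})\}\Big],$$ where $x_t = f(x_{t-1})$ for all $t\in[T]$. Expected Markovian regret: $$\operatorname{MR}_{\mathcal{A}}(T,\mathcal{F}) := \sup_{(x_0,x_1,\dots,x_T)\in\mathcal{X}^{T+1}}\Big(\mathbb{E}\Big[\sum_{t=1}^T\mathbf{1}\{\mathcal{A}(x_{<t})\ne x_t\}\Big]-\inf_{f\in\mathcal{F}}\sum_{t=1}^T\mathbf{1}\{f(x_{t-1})\ne x_t\}\Big).$$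 *)

theory Defs
  imports "HOL-Probability.Probability" "HOL-Library.Landau_Symbols"
begin

(* A randomized learner is a random prediction rule: a probability measure on the space of
   deterministic rules from finite sequences over X to X, equipped with the sigma-algebra that
   makes each prediction measurable. Predictions for different inputs may be correlated
   arbitrarily. The discrete sigma-algebra on X is intended for countable X; for such X no
   learner is excluded by it. *)
definition learners :: "'a set \<Rightarrow> ('a list \<Rightarrow> 'a) measure set" where
  "learners X = {A. prob_space A \<and> sets A = sets (PiM (lists X) (\<lambda>_. count_space X))}"

definition trajectory :: "('a \<Rightarrow> 'a) \<Rightarrow> 'a \<Rightarrow> nat \<Rightarrow> 'a" where
  "trajectory f x0 t = (f ^^ t) x0"

(* The prefix (x_0, ..., x_{t-1}). *)
definition prefix_seq :: "(nat \<Rightarrow> 'a) \<Rightarrow> nat \<Rightarrow> 'a list" where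
  "prefix_seq x t = map x [0..<t]"

(* For nonempty X and F (with every f in F mapping X to X), all suprema and infima of reals below
   are over nonempty bounded sets: the sums lie between 0 and T. *)
definition realizable_mistakes ::
    "'a set \<Rightarrow> ('a \<Rightarrow> 'a) set \<Rightarrow> ('a list \<Rightarrow> 'a) measure \<Rightarrow> nat \<Rightarrow> real" where
  "realizable_mistakes X F A T =
     (SUP x0\<in>X. SUP f\<in>F.
        (\<integral>a. (\<Sum>t=1..T. of_bool (a (prefix_seq (trajectory f x0) t)
                              \<noteq> f (trajectory f x0 (t - 1)))) \<partial>A))"

definition markovian_regret ::
    "'a set \<Rightarrow> ('a \<Rightarrow> 'a) set \<Rightarrow> ('a list \<Rightarrow> 'a) measure \<Rightarrow> nat \<Rightarrow> real" where
  "markovian_regret X F A T =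
     (SUP x\<in>{0..T} \<rightarrow>\<^sub>E X.
        (\<integral>a. (\<Sum>t=1..T. of_bool (a (prefix_seq x t) \<noteq> x t)) \<partial>A)
        - (INF f\<in>F. \<Sum>t=1..T. of_bool (f (x (t - 1)) \<noteq> x t)))"

definition realizable_learnable :: "'a set \<Rightarrow> ('a \<Rightarrow> 'a) set \<Rightarrow> bool" where
  "realizable_learnable X F \<longleftrightarrow>
     (\<lambda>T. INF A\<in>learners X. realizable_mistakes X F A T) \<in> o(\<lambda>T. real T)"

definition markovian_agnostic_learnable :: "'a set \<Rightarrow> ('a \<Rightarrow> 'a) set \<Rightarrow> bool" where
  "markovian_agnostic_learnable X F \<longleftrightarrow>
     (\<lambda>T. INF A\<in>learners X. markovian_regret X F A T) \<in> o(\<lambda>T. real T)"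

end

(* States come in three kinds: two answers 0 and 1, even questions >= 2, and odd codes >= 3.
   The hypothesis with code c answers every question, moves from either answer to the code
   2 c + 3 of itself, and stays there. A realizable trajectory thus becomes constant after two
   steps, and predicting the current state errs at most twice. In the agnostic setting the
   sequence alternates between questions and answers and avoids the codes. The adversary takes
   the next question among four fresh ones and the answer among two, always the one that is the
   least likely to be predicted; so the learner errs with probability at least 3/4 on questions
   and 1/2 on answers, whereas some hypothesis errs on the questions only. *)
theory Submission
  imports Defs
begin

section \<open>Predictions of a learner and their expected mistakes\<close>

lemma learners_UNIV:
  "learners UNIV = {A. prob_space A \<and> sets A = sets (PiM UNIV (\<lambda>_. count_space UNIV))}"
  by (simp add: learners_def)

lemma space_learner:
  assumes "A \<in> learners UNIV"
  shows "space A = UNIV"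
proof -
  have "space A = space (PiM UNIV (\<lambda>_. count_space UNIV))"
    using assms by (intro sets_eq_imp_space_eq) (simp add: learners_UNIV)
  then show ?thesis by (simp add: space_PiM)
qed

lemma prediction_measurable:
  assumes "A \<in> learners UNIV"
  shows "(\<lambda>a. a w) \<in> measurable A (count_space UNIV)"
proof -
  have "(\<lambda>a. a w) \<in> measurable (PiM UNIV (\<lambda>_. count_space UNIV)) (count_space UNIV)"
    by (rule measurable_component_singleton) simp
  then show ?thesis
    using assms measurable_cong_sets[of A _ "count_space UNIV"] by (auto simp: learners_UNIV)
qed

lemma prediction_event_sets:
  assumes "A \<in> learners UNIV"
  shows "{a. P (a w)} \<in> sets A"
proof -
  have "(\<lambda>a. a w) -` {y. P y} \<inter> space A \<in> sets A"
    by (rule measurable_sets[OF prediction_measurable[OF assms]]) simp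
  then show ?thesis by (simp add: space_learner[OF assms] vimage_def)
qed

lemma mistake_integrable:
  assumes A: "A \<in> learners UNIV"
  shows "integrable A (\<lambda>a. of_bool (a w \<noteq> y) :: real)"
    and "(\<integral>a. of_bool (a w \<noteq> y) \<partial>A) = 1 - measure A {a. a w = y}"
proof -
  interpret prob_space A using A by (simp add: learners_UNIV)
  have ind: "(\<lambda>a. of_bool (a w \<noteq> y) :: real) = indicator {a. a w \<noteq> y}"
    by (auto simp: indicator_def)
  have ev: "{a. a w \<noteq> y} \<in> sets A" "{a. a w = y} \<in> sets A"
    using prediction_event_sets[OF A, of "\<lambda>z. z \<noteq> y" w]
      prediction_event_sets[OF A, of "\<lambda>z. z = y" w] by auto
  show "integrable A (\<lambda>a. of_bool (a w \<noteq> y) :: real)"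
    unfolding ind using ev by (simp add: less_top[symmetric])
  have "{a. a w \<noteq> y} = space A - {a. a w = y}" by (auto simp: space_learner[OF A])
  then show "(\<integral>a. of_bool (a w \<noteq> y) \<partial>A) = 1 - measure A {a. a w = y}"
    unfolding ind using ev prob_compl[of "{a. a w = y}"] by (simp add: space_learner[OF A])
qed

text \<open>By linearity only the law of each single prediction matters; correlations between
  predictions drop out.\<close>

lemma expected_mistakes:
  assumes A: "A \<in> learners UNIV"
  shows "(\<integral>a. (\<Sum>t=1..T. of_bool (a (w t) \<noteq> y t)) \<partial>A)
           = (\<Sum>t=1..T. 1 - measure A {a. a (w t) = y t} :: real)"
  using mistake_integrable[OF A] by (subst Bochner_Integration.integral_sum) auto

lemma expected_mistakes_bounds:
  assumes A: "A \<in> learners UNIV"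
  shows "(0::real) \<le> (\<integral>a. (\<Sum>t=1..T. of_bool (a (w t) \<noteq> y t)) \<partial>A)"
    and "(\<integral>a. (\<Sum>t=1..T. of_bool (a (w t) \<noteq> y t)) \<partial>A) \<le> real T"
proof -
  interpret prob_space A using A by (simp add: learners_UNIV)
  show "(0::real) \<le> (\<integral>a. (\<Sum>t=1..T. of_bool (a (w t) \<noteq> y t)) \<partial>A)"
    unfolding expected_mistakes[OF A] by (intro sum_nonneg) simp
  have "(\<Sum>t=1..T. 1 - measure A {a. a (w t) = y t}) \<le> (\<Sum>t=1..T. 1)"
    by (intro sum_mono) simp
  then show "(\<integral>a. (\<Sum>t=1..T. of_bool (a (w t) \<noteq> y t)) \<partial>A) \<le> real T"
    unfolding expected_mistakes[OF A] by simp
qed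

text \<open>The point mass at \<open>r\<close> is the deterministic learner \<open>r\<close>. It
  also witnesses that infima over learners range over a nonempty set.\<close>

lemma return_learner:
  "return (PiM UNIV (\<lambda>_. count_space UNIV)) r \<in> learners UNIV"
  by (auto simp: learners_UNIV space_PiM intro!: prob_space_return)

lemma expected_mistakes_return:
  fixes r :: "'a list \<Rightarrow> 'a"
  defines "A \<equiv> return (PiM UNIV (\<lambda>_. count_space UNIV)) r"
  shows "(\<integral>a. (\<Sum>t=1..T. of_bool (a (w t) \<noteq> y t)) \<partial>A)
           = (\<Sum>t=1..T. of_bool (r (w t) \<noteq> y t) :: real)"
proof -
  have A: "A \<in> learners UNIV" unfolding A_def by (rule return_learner)
  have "measure A {a. a (w t) = y t} = of_bool (r (w t) = y t)" for t
    using prediction_event_sets[OF A, of "\<lambda>z. z = y t" "w t"]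
    unfolding A_def by (auto simp: measure_return indicator_def)
  then show ?thesis
    unfolding expected_mistakes[OF A] by (intro sum.cong) auto
qed

section \<open>Bounds through conditional suprema and infima\<close>

lemma realizable_mistakes_nonneg:
  assumes A: "A \<in> learners UNIV" and F: "F \<noteq> {}"
  shows "0 \<le> realizable_mistakes UNIV F A T"
proof -
  define e where "e x0 f = ((\<integral>a. (\<Sum>t=1..T. of_bool (a (prefix_seq (trajectory f x0) t)
      \<noteq> f (trajectory f x0 (t - 1)))) \<partial>A) :: real)" for x0 f
  have e: "0 \<le> e x0 f" "e x0 f \<le> T" for x0 f
    unfolding e_def by (rule expected_mistakes_bounds[OF A])+
  obtain f0 where f0: "f0 \<in> F" using F by blast
  have inner: "0 \<le> (SUP f\<in>F. e x0 f)" "(SUP f\<in>F. e x0 f) \<le> T" for x0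
    using e F f0 by (auto intro!: cSUP_least cSUP_upper2[of _ _ f0] bdd_aboveI2[of _ _ "real T"])
  have "0 \<le> (SUP x0\<in>UNIV. SUP f\<in>F. e x0 f)"
  proof (rule cSUP_upper2)
    show "bdd_above (range (\<lambda>x0. SUP f\<in>F. e x0 f))" by (rule bdd_aboveI2) (rule inner(2))
    show "0 \<le> (SUP f\<in>F. e undefined f)" by (rule inner(1))
  qed simp
  then show ?thesis by (simp add: realizable_mistakes_def e_def)
qed

lemma realizable_learnable_if_bounded:
  assumes A: "A \<in> learners UNIV" and F: "F \<noteq> {}"
    and le: "\<And>T. realizable_mistakes UNIV F A T \<le> B"
  shows "realizable_learnable UNIV F"
proof -
  let ?m = "\<lambda>T. INF A\<in>learners UNIV. realizable_mistakes UNIV F A T"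
  have "0 \<le> ?m T" for T
    using A F by (intro cINF_greatest realizable_mistakes_nonneg) auto
  \<comment> \<open>A real infimum is known to lie below a member once the set is bounded below, so
    nonnegativity serves the upper bound as well.\<close>
  moreover have "?m T \<le> B" for T
    using A F le[of T]
    by (intro cINF_lower2[of _ _ A] bdd_belowI2[of _ 0] realizable_mistakes_nonneg) auto
  ultimately have "?m \<in> O(\<lambda>_. 1)"
    by (intro bigoI[of _ B]) auto
  also have "(\<lambda>_. 1) \<in> o(\<lambda>T. real T)"
    by (intro smalloI_tendsto tendsto_divide_0[OF tendsto_const]
        filterlim_at_top_imp_at_infinity[OF filterlim_real_sequentially] eventually_mono
          [OF eventually_gt_at_top[of 0]]) auto
  finally show ?thesis by (simp add: realizable_learnable_def)
qed

text \<open>One sequence and one comparator suffice for a lower bound: \<open>f\<close> loses at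
  least the infimum, and the supremum dominates each of its values because all are at most
  \<open>T\<close>.\<close>

lemma markovian_regret_ge:
  assumes A: "A \<in> learners UNIV" and f: "f \<in> F" and x: "x \<in> {0..T} \<rightarrow>\<^sub>E UNIV"
  shows "(\<Sum>t=1..T. 1 - measure A {a. a (prefix_seq x t) = x t})
           - (\<Sum>t=1..T. of_bool (f (x (t - 1)) \<noteq> x t)) \<le> markovian_regret UNIV F A T"
proof -
  let ?e = "\<lambda>x. \<integral>a. (\<Sum>t=1..T. of_bool (a (prefix_seq x t) \<noteq> x t)) \<partial>A"
  let ?l = "\<lambda>x f. \<Sum>t=1..T. of_bool (f (x (t - 1)) \<noteq> x t) :: real"
  have nn: "0 \<le> ?l x f" for x f by (intro sum_nonneg) simp
  have "(INF f\<in>F. ?l x f) \<le> ?l x f"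
    using f nn by (intro cINF_lower bdd_belowI2[of _ 0])
  moreover have "?e x - (INF f\<in>F. ?l x f) \<le> markovian_regret UNIV F A T"
    unfolding markovian_regret_def
  proof (intro cSUP_upper[OF x] bdd_aboveI2)
    fix z :: "nat \<Rightarrow> 'a"
    have "0 \<le> (INF f\<in>F. ?l z f)" using f nn by (intro cINF_greatest) auto
    moreover have "?e z \<le> real T" by (rule expected_mistakes_bounds[OF A])
    ultimately show "?e z - (INF f\<in>F. ?l z f) \<le> real T" by linarith
  qed
  ultimately show ?thesis unfolding expected_mistakes[OF A] by linarith
qed

section \<open>Sequences adapted to the law of the learner\<close>

lemma unlikely_prediction:
  assumes A: "A \<in> learners UNIV" and C: "finite C" "C \<noteq> {}"
  shows "\<exists>y\<in>C. measure A {a. a w = y} \<le> 1 / card C"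
proof (rule ccontr)
  interpret prob_space A using A by (simp add: learners_UNIV)
  assume "\<not> ?thesis"
  \<comment> \<open>Distinct predictions are disjoint events, so their probabilities sum to at most
    1 and cannot all exceed \<open>1 / card C\<close>.\<close>
  then have "(\<Sum>y\<in>C. 1 / card C) < (\<Sum>y\<in>C. measure A {a. a w = y})"
    using C by (intro sum_strict_mono) auto
  also have "\<dots> = measure A (\<Union>y\<in>C. {a. a w = y})"
    using prediction_event_sets[OF A, where P = "\<lambda>z. z = y" for y] C
    by (intro finite_measure_finite_Union[symmetric]) (auto simp: disjoint_family_on_def)
  also have "\<dots> \<le> 1" by simp
  finally show False using C by simp
qed

lemma adaptive_sequence_exists:
  assumes "\<And>w. \<exists>y. P w y"
  shows "\<exists>x. \<forall>t. P (prefix_seq x t) (x t)"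
proof -
  define pick where "pick w = (SOME y. P w y)" for w
  have pick: "P w (pick w)" for w unfolding pick_def using assms by (rule someI_ex)
  define h where "h = rec_nat [] (\<lambda>_ w. w @ [pick w])"
  \<comment> \<open>The histories grown by appending are the prefixes of the sequence they define,
    so \<open>pick (h t)\<close> responds to the actual past.\<close>
  have "prefix_seq (\<lambda>t. pick (h t)) t = h t" for t
    by (induction t) (simp_all add: h_def prefix_seq_def)
  then show ?thesis using pick by (intro exI[of _ "\<lambda>t. pick (h t)"]) simp
qed

text \<open>The adversary consults the probabilities of predictions, never their outcomes, so its
  adaptive choices amount to one fixed sequence.\<close>

lemma unlikely_sequence_exists:
  assumes A: "A \<in> learners UNIV" and C: "\<And>t. finite (C t)" "\<And>t. C t \<noteq> {}"
  shows "\<exists>x. \<forall>t. x t \<in> C t \<and> measure A {a. a (prefix_seq x t) = x t} \<le> 1 / card (C t)"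
proof -
  \<comment> \<open>The length of the history recovers the time.\<close>
  have "\<exists>y. y \<in> C (length w) \<and> measure A {a. a w = y} \<le> 1 / card (C (length w))" for w
    using unlikely_prediction[OF A C] by blast
  from adaptive_sequence_exists[of "\<lambda>w y. y \<in> C (length w) \<and>
      measure A {a. a w = y} \<le> 1 / card (C (length w))", OF this]
  show ?thesis by (simp add: prefix_seq_def)
qed

section \<open>The class, its realizable bound and its regret\<close>

definition hyp :: "nat \<Rightarrow> nat \<Rightarrow> nat" where
  "hyp c x = (if x < 2 then 2 * c + 3 else if odd x then x else of_bool (x \<in> set_decode c))"

text \<open>Two steps from any state end in an odd number at least 3, which is a fixed
  point.\<close>

lemma hyp_idem: "hyp c (hyp c (hyp c x)) = hyp c (hyp c x)"
  by (simp add: hyp_def)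

lemma realizable_mistakes_hyp:
  "realizable_mistakes UNIV (range hyp)
     (return (PiM UNIV (\<lambda>_. count_space UNIV)) last) T \<le> 2"
  unfolding realizable_mistakes_def expected_mistakes_return
proof (intro cSUP_least; (elim rangeE)?)
  fix x0 f c assume f: "f = hyp c"
  \<comment> \<open>Rounds start at 1, so \<open>last\<close> never meets the empty list
    here.\<close>
  have stay: "last (prefix_seq (trajectory f x0) t) = trajectory f x0 (t - 1)" if "t \<ge> 1" for t
    using that by (cases t) (simp_all add: prefix_seq_def)
  have "f (trajectory f x0 (t - 1)) = trajectory f x0 (t - 1)" if "t \<ge> 3" for t
  proof -
    \<comment> \<open>From round 3 on, the current state is two steps past an earlier one, the form
      that \<open>hyp_idem\<close> covers.\<close>
    have "t - 1 = Suc (Suc (t - 3))" using that by simp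
    then show ?thesis by (simp only: trajectory_def f funpow.simps comp_apply hyp_idem)
  qed
  then have "(\<Sum>t=1..T. of_bool (last (prefix_seq (trajectory f x0) t)
        \<noteq> f (trajectory f x0 (t - 1)))) \<le> (\<Sum>t=1..T. of_bool (t < 3) :: real)"
    by (intro sum_mono) (force simp: stay not_less[symmetric])
  also have "\<dots> = card ({1..T} \<inter> {t. t < 3})"
    by simp
  also have "\<dots> \<le> card {1::nat,2}"
    by (intro of_nat_mono card_mono) auto
  finally show "(\<Sum>t=1..T. of_bool (last (prefix_seq (trajectory f x0) t)
        \<noteq> f (trajectory f x0 (t - 1))) :: real) \<le> 2" by simp
qed auto

text \<open>The factor 8 keeps the blocks of distinct times disjoint. With two questions per block,
  the net loss 1/2 on a question would cancel the gain 1/2 on an answer; four leave a gain of 1/4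
  per pair.\<close>

definition options :: "nat \<Rightarrow> nat set" where
  "options t = (if even t then {8*t+2, 8*t+4, 8*t+6, 8*t+8} else {0, 1})"

text \<open>No question repeats, so every pattern of answers is consistent; up to time
  \<open>T\<close> the questions answered by 1 form a finite set, which \<open>set_encode\<close>
  turns into a code.\<close>

lemma hyp_answers:
  assumes x: "\<And>t. x t \<in> options t"
  shows "\<exists>c. \<forall>t\<in>{1..T}. odd t \<longrightarrow> hyp c (x (t - 1)) = x t"
proof -
  define S where "S = (\<lambda>t. x (t - 1)) ` {t\<in>{1..T}. odd t \<and> x t = 1}"
  have "hyp (set_encode S) (x (t - 1)) = x t" if t: "t \<in> {1..T}" "odd t" for t
  proof -
    have opts: "x (s - 1) \<in> {8*(s-1)+2, 8*(s-1)+4, 8*(s-1)+6, 8*(s-1)+8}" if "odd s" for s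
      using x[of "s - 1"] that by (simp add: options_def)
    have inj: "s = t" if "odd s" "x (t - 1) = x (s - 1)" for s
    proof -
      \<comment> \<open>This excludes \<open>s = 0\<close>, whose truncated predecessor equals that
        of 1.\<close>
      have "s \<ge> 1" using that odd_pos[of s] by simp
      then show ?thesis using opts[OF that(1)] opts[OF t(2)] that(2) t(1) by auto
    qed
    have "x (t - 1) \<in> S \<longleftrightarrow> x t = 1"
      using inj t unfolding S_def by (auto simp: image_iff)
    moreover have "x t \<in> {0, 1}" using x[of t] t by (simp add: options_def)
    moreover have "even (x (t - 1))" "x (t - 1) \<ge> 2" using opts[OF t(2)] by auto
    moreover have "finite S" by (simp add: S_def)
    ultimately show ?thesis by (auto simp: hyp_def)
  qed
  then show ?thesis by blast
qed

text \<open>An answer nets 1/2 - 0 and a question 3/4 - 1. The first predicted state is an answer,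
  so an odd \<open>T\<close> ends with a surplus.\<close>

lemma sum_alternating_ge: "real T / 8 \<le> (\<Sum>t=1..T. if odd t then 1/2 else - 1/4)"
proof -
  \<comment> \<open>The bound alone is not inductive, since it is lost across a question; the exact
    value is.\<close>
  have "(\<Sum>t=1..T. if odd t then 1/2 else - 1/4) = real T / 8 + (if odd T then 3/8 else 0)"
    by (induction T) (auto simp: field_simps)
  then show ?thesis by simp
qed

lemma markovian_regret_hyp_ge:
  assumes A: "A \<in> learners UNIV"
  shows "real T / 8 \<le> markovian_regret UNIV (range hyp) A T"
proof -
  have "finite (options t)" "options t \<noteq> {}" for t by (simp_all add: options_def)
  from unlikely_sequence_exists[OF A this] obtain x where
    x: "\<And>t. x t \<in> options t"
      "\<And>t. measure A {a. a (prefix_seq x t) = x t} \<le> 1 / card (options t)" by metis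
  from hyp_answers[OF x(1)] obtain c where
    c: "\<And>t. t \<in> {1..T} \<Longrightarrow> odd t \<Longrightarrow> hyp c (x (t - 1)) = x t" by blast
  \<comment> \<open>The regret ranges over extensional functions on \<open>{0..T}\<close>.\<close>
  define z where "z = restrict x {0..T}"
  have z: "prefix_seq z t = prefix_seq x t" "z t = x t" "z (t - 1) = x (t - 1)"
    if "t \<in> {1..T}" for t using that by (auto simp: z_def prefix_seq_def)
  have "real T / 8 \<le> (\<Sum>t=1..T. if odd t then 1/2 else - 1/4)" by (rule sum_alternating_ge)
  also have "\<dots> \<le> (\<Sum>t=1..T. (1 - measure A {a. a (prefix_seq z t) = z t})
                     - of_bool (hyp c (z (t - 1)) \<noteq> z t))"
  proof (intro sum_mono)
    fix t assume t: "t \<in> {1..T}"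
    have "card (options t) = (if odd t then 2 else 4)" by (simp add: options_def)
    then show "(if odd t then 1/2 else - 1/4) \<le> (1 - measure A {a. a (prefix_seq z t) = z t})
                     - of_bool (hyp c (z (t - 1)) \<noteq> z t)"
      using x(2)[of t] c[OF t] z[OF t] by (auto split: if_splits simp: of_bool_def)
  qed
  also have "\<dots> \<le> markovian_regret UNIV (range hyp) A T"
    using markovian_regret_ge[OF A, of "hyp c" "range hyp" z T]
    by (simp add: sum_subtractf z_def del: sum_of_bool_eq)
  finally show ?thesis .
qed

lemma not_agnostic_learnable_hyp: "\<not> markovian_agnostic_learnable UNIV (range hyp)"
proof
  let ?m = "\<lambda>T. INF A\<in>learners UNIV. markovian_regret UNIV (range hyp) A T"
  assume "markovian_agnostic_learnable UNIV (range hyp)"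
  \<comment> \<open>Any constant below 1/8 would do; \<open>T > 0\<close> then makes the
    contradiction strict.\<close>
  then have "eventually (\<lambda>T. norm (?m T) \<le> 1/16 * norm (real T)) sequentially"
    unfolding markovian_agnostic_learnable_def by (rule landau_o.smallD) simp
  then have "eventually (\<lambda>T. norm (?m T) \<le> 1/16 * norm (real T) \<and> T > 0) sequentially"
    using eventually_gt_at_top by (rule eventually_conj)
  then obtain T where T: "norm (?m T) \<le> 1/16 * norm (real T)" "T > 0"
    by (auto simp: eventually_sequentially)
  have "real T / 8 \<le> ?m T"
    using return_learner by (intro cINF_greatest markovian_regret_hyp_ge) auto
  then show False using T by simp
qed

theorem corollary16:
  "\<exists>(X :: nat set) (F :: (nat \<Rightarrow> nat) set).
     X \<noteq> {} \<and> F \<noteq> {} \<and> F \<subseteq> X \<rightarrow>\<^sub>E X \<and>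
     realizable_learnable X F \<and>
     \<not> markovian_agnostic_learnable X F"
proof (intro exI conjI)
  show "realizable_learnable UNIV (range hyp)"
    by (rule realizable_learnable_if_bounded[OF return_learner _ realizable_mistakes_hyp]) simp
  show "\<not> markovian_agnostic_learnable UNIV (range hyp)" by (rule not_agnostic_learnable_hyp)
qed auto

end
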